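(* Let $p$ be a prime, and let $r,s$ be integers with $0 \leq s \leq r \leq p-1$. The following are equivalent: 1. $(r,s) \in D(p)$; 2. $H_r \equiv H_{r-s} \equiv H_s \pmod p$; 3. $\binom{r}{s} \equiv (-1)^{r-s}\binom{p-1-s}{r-s} \equiv (-1)^s\binom{p-1-r+s}{s} \pmod{p^2}$.
   Context: For a prime $p$, $D(p)$ denotes the set of pairs $(r,s) \in \{0,1,\dots,p-1\}^2$ such that $\binom{pa+r}{pb+s} \equiv \binom{a}{b}\binom{r}{s} \pmod{p^2}$ for all integers $a \geq 0$ and $b \geq 0$ (binomial coefficients $\binom{n}{k}$ with $k>n\geq 0$ are $0$). $H_n = 1 + \frac12 + \dots + \frac1n$ is the $n$th harmonic number, with $H_0 = 0$; for $0 \leq n \leq p-1$ its denominator is coprime to $p$, so it can be reduced modulo $p$. *)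

theory Defs
  imports "HOL-Number_Theory.Number_Theory" "HOL-Analysis.Harmonic_Numbers"
begin

definition D :: "nat \<Rightarrow> (nat \<times> nat) set" where
  "D p = {(r, s). r < p \<and> s < p \<and>
     (\<forall>a b. [(p * a + r) choose (p * b + s) = (a choose b) * (r choose s)] (mod p\<^sup>2))}"

text \<open>
  The localization of the integers at the prime \<open>p\<close>, i.e. the fractions whose denominator is
  coprime to \<open>p\<close>. It is polymorphic in the ambient field because the library's \<^const>\<open>harm\<close> takes
  its values in a \<^class>\<open>real_normed_field\<close>, which excludes the type \<^typ>\<open>rat\<close>.
\<close>

definition p_integers :: "nat \<Rightarrow> 'a::field_char_0 set" where
  "p_integers p = {of_int m / of_int n |m n. coprime n (int p)}"

definition p_cong :: "nat \<Rightarrow> 'a::field_char_0 \<Rightarrow> 'a \<Rightarrow> bool" where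
  "p_cong p x y \<longleftrightarrow> x \<in> p_integers p \<and> y \<in> p_integers p \<and>
     (\<exists>z \<in> p_integers p. x - y = of_nat p * z)"

lemma of_int_in_p_integers: "of_int m \<in> p_integers p"
  unfolding p_integers_def by (rule CollectI, rule exI[of _ m], rule exI[of _ 1]) simp

lemma p_cong_of_int_iff:
  assumes "prime p"
  shows "p_cong p (of_int x :: 'a::field_char_0) (of_int y) \<longleftrightarrow> [x = y] (mod int p)"
proof
  assume "p_cong p (of_int x :: 'a) (of_int y)"
  then obtain m n where n: "coprime n (int p)"
    and eq: "(of_int x - of_int y :: 'a) = of_nat p * (of_int m / of_int n)"
    unfolding p_cong_def p_integers_def by blast
  have "n \<noteq> 0" using n assms by auto
  with eq have "(of_int ((x - y) * n) :: 'a) = of_int (int p * m)"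
    by (simp add: field_simps)
  hence "(x - y) * n = int p * m" by (simp only: of_int_eq_iff)
  hence "int p dvd (x - y) * n" by simp
  thus "[x = y] (mod int p)"
    using n by (simp add: cong_iff_dvd_diff coprime_commute coprime_dvd_mult_left_iff)
next
  assume "[x = y] (mod int p)"
  then obtain k where "x - y = int p * k" by (auto simp: cong_iff_dvd_diff dvd_def)
  hence "(of_int x - of_int y :: 'a) = of_nat p * of_int k"
    by (metis of_int_diff of_int_mult of_int_of_nat_eq)
  thus "p_cong p (of_int x :: 'a) (of_int y)"
    unfolding p_cong_def using of_int_in_p_integers by blast
qed

lemma harm_in_p_integers:
  assumes "prime p" "n < p"
  shows "harm n \<in> p_integers p"
  using assms(2)
proof (induction n)
  case 0
  show ?case using of_int_in_p_integers[of 0 p] by (simp add: harm_def)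
next
  case (Suc n)
  then obtain a b where b: "coprime b (int p)" and ab: "harm n = (of_int a / of_int b :: 'a)"
    by (auto simp: p_integers_def)
  have "b \<noteq> 0" using b assms(1) by auto
  have "\<not> p dvd Suc n" using Suc.prems by (auto dest: dvd_imp_le)
  hence "coprime (Suc n) p" using assms(1) by (metis coprime_commute prime_imp_coprime)
  hence c: "coprime (b * int (Suc n)) (int p)" using b
    by (metis coprime_int_iff coprime_mult_left_iff)
  have nz: "(of_nat (Suc n) :: 'a) \<noteq> 0" by (rule of_nat_neq_0)
  have "(harm (Suc n) :: 'a) = of_int a / of_int b + 1 / of_nat (Suc n)"
    unfolding harm_Suc ab by (simp only: inverse_eq_divide)
  also have "\<dots> = of_int (a * int (Suc n) + b) / of_int (b * int (Suc n))"
    using \<open>b \<noteq> 0\<close> nz by (simp add: field_simps del: of_nat_Suc)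
  finally show ?case using c unfolding p_integers_def by blast
qed

end

theory Submission
  imports Defs
begin

text \<open>
  Expanding \<open>\<Prod>i=1..n. (p x + i) \<equiv> n! (1 + p x H\<^sub>n)\<close> modulo \<open>p\<^sup>2\<close> and using
  \<open>(pa choose pb) \<equiv> (a choose b)\<close> gives
  \<open>(pa + r choose pb + s) \<equiv> (a choose b) (r choose s) (1 + p (a H\<^sub>r - b H\<^sub>s - (a - b) H\<^sub>r\<^sub>-\<^sub>s))\<close>,
  so that membership in \<open>D p\<close> is decided by \<open>(a, b) = (1, 0)\<close> and \<open>(1, 1)\<close>. The same expansion
  at \<open>x = -1\<close> gives
  \<open>(-1)\<^sup>r\<^sup>-\<^sup>s (p - 1 - s choose r - s) \<equiv> (r choose s) (1 - p (H\<^sub>r - H\<^sub>s))\<close>.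
\<close>

section \<open>Congruences in the localization\<close>

lemma p_integers_minus:
  assumes "x \<in> p_integers p"
  shows "- x \<in> p_integers p"
proof -
  obtain m n where "coprime n (int p)" "x = of_int m / of_int n"
    using assms unfolding p_integers_def by blast
  moreover from this have "- x = of_int (- m) / of_int n" by simp
  ultimately show ?thesis unfolding p_integers_def by blast
qed

lemma p_integers_add:
  assumes "prime p" "x \<in> p_integers p" "y \<in> p_integers p"
  shows "x + y \<in> p_integers p"
proof -
  obtain m n where mn: "coprime n (int p)" "x = of_int m / of_int n"
    using assms(2) unfolding p_integers_def by blast
  obtain k l where kl: "coprime l (int p)" "y = of_int k / of_int l"
    using assms(3) unfolding p_integers_def by blast
  have "n \<noteq> 0" "l \<noteq> 0" using mn(1) kl(1) assms(1) by auto
  hence "x + y = of_int (m * l + k * n) / of_int (n * l)"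
    by (simp add: mn(2) kl(2) field_simps)
  moreover have "coprime (n * l) (int p)" using mn(1) kl(1) by simp
  ultimately show ?thesis unfolding p_integers_def by blast
qed

lemma p_cong_sym:
  assumes "p_cong p x y"
  shows "p_cong p y x"
proof -
  obtain u where u: "u \<in> p_integers p" "x - y = of_nat p * u"
    using assms unfolding p_cong_def by blast
  have "y - x = - (x - y)" by simp
  also have "\<dots> = of_nat p * - u" by (simp only: u mult_minus_right)
  finally show ?thesis using p_integers_minus[OF u(1)] assms unfolding p_cong_def by blast
qed

lemma p_cong_trans:
  assumes "prime p" "p_cong p x y" "p_cong p y z"
  shows "p_cong p x z"
proof -
  obtain u v where uv: "u \<in> p_integers p" "x - y = of_nat p * u"
    "v \<in> p_integers p" "y - z = of_nat p * v"
    using assms(2,3) unfolding p_cong_def by blast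
  have "x - z = (x - y) + (y - z)" by simp
  also have "\<dots> = of_nat p * (u + v)" by (simp only: uv distrib_left)
  finally show ?thesis
    using p_integers_add[OF assms(1) uv(1,3)] assms(2,3) unfolding p_cong_def by blast
qed

lemma p_cong_add:
  assumes "prime p" "p_cong p x y" "p_cong p x' y'"
  shows "p_cong p (x + x') (y + y')"
proof -
  obtain u v where uv: "u \<in> p_integers p" "x - y = of_nat p * u"
    "v \<in> p_integers p" "x' - y' = of_nat p * v"
    using assms(2,3) unfolding p_cong_def by blast
  have "(x + x') - (y + y') = (x - y) + (x' - y')" by simp
  also have "\<dots> = of_nat p * (u + v)" by (simp only: uv distrib_left)
  finally show ?thesis
    using p_integers_add[OF assms(1)] uv(1,3) assms(2,3) unfolding p_cong_def by blast
qed

section \<open>Integer representatives of harmonic numbers modulo p\<close>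

lemma coprime_int_less_prime:
  assumes "prime p" "0 < i" "i < p"
  shows "coprime (int i) (int p)"
  using assms by (metis coprime_commute coprime_int_iff nat_dvd_not_less prime_imp_coprime)

text \<open>Writing \<open>1 - i * j = p * k\<close> for the modular inverse \<open>j\<close> and
  dividing by \<open>i\<close> leaves \<open>p * (k / i)\<close>, where \<open>k / i\<close> is
  p-integral because \<open>0 < i < p\<close>.\<close>

lemma p_cong_inverse:
  assumes "prime p" "0 < i" "i < p"
  shows "p_cong p (inverse (of_nat i) :: 'a::field_char_0)
           (of_int (modular_inverse (int p) (int i)))"
proof -
  let ?j = "modular_inverse (int p) (int i)"
  have cop: "coprime (int i) (int p)" using assms by (rule coprime_int_less_prime)
  hence "[1 = int i * ?j] (mod int p)"
    by (rule cong_sym[OF cong_modular_inverse1])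
  then obtain k where k: "1 - int i * ?j = int p * k"
    by (auto simp: cong_iff_dvd_diff dvd_def)
  have "(1 - of_nat i * of_int ?j :: 'a) = of_int (1 - int i * ?j)" by simp
  also have "\<dots> = of_nat p * of_int k" by (simp add: k)
  finally have eq: "(1 - of_nat i * of_int ?j :: 'a) = of_nat p * of_int k" .
  have "(of_nat i :: 'a) \<noteq> 0" using assms(2) by simp
  hence "inverse (of_nat i) - of_int ?j = (1 - of_nat i * of_int ?j) / (of_nat i :: 'a)"
    by (simp add: field_simps)
  also have "\<dots> = of_nat p * (of_int k / of_int (int i))" by (simp add: eq)
  finally have "inverse (of_nat i) - of_int ?j = of_nat p * (of_int k / of_int (int i) :: 'a)" .
  moreover have "of_int k / of_int (int i) \<in> (p_integers p :: 'a set)"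
    unfolding p_integers_def using cop by blast
  moreover have "inverse (of_nat i) = (of_int 1 / of_int (int i) :: 'a)"
    by (simp add: inverse_eq_divide)
  hence "(inverse (of_nat i) :: 'a) \<in> p_integers p"
    unfolding p_integers_def using cop by blast
  ultimately show ?thesis unfolding p_cong_def using of_int_in_p_integers by blast
qed

text \<open>For \<open>n < p\<close>, an integer standing for H_n modulo p. Harmonic numbers enter
  the expansions modulo p^2 only with a factor p, so this residue suffices and the computations can
  stay in \<open>int\<close>.\<close>

definition harm_mod :: "nat \<Rightarrow> nat \<Rightarrow> int" where
  "harm_mod p n = (\<Sum>i=1..n. modular_inverse (int p) (int i))"

lemma harm_mod_0 [simp]: "harm_mod p 0 = 0"
  by (simp add: harm_mod_def)

lemma harm_mod_Suc:
  "harm_mod p (Suc n) = harm_mod p n + modular_inverse (int p) (int (Suc n))"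
  by (simp add: harm_mod_def)

lemma p_cong_harm_harm_mod:
  assumes "prime p" "n < p"
  shows "p_cong p (harm n) (of_int (harm_mod p n))"
  using assms(2)
proof (induction n)
  case 0
  show ?case
    using p_cong_of_int_iff[OF assms(1), of 0 0] by (simp add: harm_def)
next
  case (Suc n)
  have "p_cong p (inverse (of_nat (Suc n)) :: 'a)
      (of_int (modular_inverse (int p) (int (Suc n))))"
    using Suc.prems by (intro p_cong_inverse[OF assms(1)]) auto
  from p_cong_add[OF assms(1) Suc.IH this] Suc.prems show ?case
    by (simp only: harm_Suc harm_mod_Suc of_int_add Suc_lessD)
qed

lemma p_cong_harm_iff:
  assumes "prime p" "m < p" "n < p"
  shows "p_cong p (harm m :: 'a::real_normed_field) (harm n)
         \<longleftrightarrow> [harm_mod p m = harm_mod p n] (mod int p)"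
proof -
  have "p_cong p (harm m :: 'a) (harm n)
      \<longleftrightarrow> p_cong p (of_int (harm_mod p m) :: 'a) (of_int (harm_mod p n))"
    using p_cong_harm_harm_mod[OF assms(1,2)] p_cong_harm_harm_mod[OF assms(1,3)]
    by (meson p_cong_sym p_cong_trans[OF assms(1)])
  thus ?thesis by (simp only: p_cong_of_int_iff[OF assms(1)])
qed

section \<open>Expansions modulo the square of a prime\<close>

text \<open>Each factor p x + i is i (1 + p x / i), and modulo p^2 only the terms linear in p
  survive. Any integer \<open>x\<close> is allowed, in particular -1.\<close>

lemma pochhammer_cong_harm_mod:
  assumes "prime p" "n < p"
  shows "[pochhammer (int p * x + 1) n = fact n * (1 + int p * (x * harm_mod p n))]
           (mod (int p)\<^sup>2)"
  using assms(2)
proof (induction n)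
  case 0
  show ?case by simp
next
  case (Suc n)
  define h i j where "h = harm_mod p n" and "i = int (Suc n)" and "j = modular_inverse (int p) i"
  have "[i * j = 1] (mod int p)"
    unfolding j_def i_def using Suc.prems
    by (intro cong_modular_inverse1 coprime_int_less_prime[OF assms(1)]) auto
  then obtain k where k: "i * j = 1 + int p * k"
    by (metis cong_iff_lin cong_sym mult.commute)
  have "[pochhammer (int p * x + 1) n * (int p * x + i)
      = fact n * (1 + int p * (x * h)) * (int p * x + i)] (mod (int p)\<^sup>2)"
    unfolding h_def using Suc by (intro cong_mult) auto
  \<comment> \<open>The summand \<open>int p * x\<close> is traded for
    \<open>int p * x * (i * j)\<close>, at the cost of a multiple of p^2, so that the factor
    \<open>i\<close> can be pulled out and completes \<open>fact (Suc n)\<close>.\<close>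
  also have "fact n * (1 + int p * (x * h)) * (int p * x + i)
      = fact n * (i * (1 + int p * (x * h)) + int p * x * (i * j))
        + (int p)\<^sup>2 * (fact n * (x * x * h - x * k))"
    unfolding k by (simp add: algebra_simps power2_eq_square)
  also have "[\<dots> = fact n * (i * (1 + int p * (x * h)) + int p * x * (i * j))] (mod (int p)\<^sup>2)"
    by (simp add: cong_iff_dvd_diff)
  also have "fact n * (i * (1 + int p * (x * h)) + int p * x * (i * j))
      = fact (Suc n) * (1 + int p * (x * (h + j)))"
    by (simp add: i_def algebra_simps)
  finally show ?case
    by (simp add: pochhammer_Suc harm_mod_Suc h_def i_def j_def add_ac)
qed

section \<open>Binomial coefficients with both indices multiples of p\<close>

lemma prime_dvd_choose_if_dvd_upper:
  assumes "prime p" "p dvd n" "\<not> p dvd k"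
  shows "p dvd (n choose k)"
proof -
  have "k > 0" using assms(3) by (cases k) auto
  hence "p dvd k * (n choose k)" using assms(2) by (simp add: times_binomial_minus1_eq)
  thus ?thesis using assms(1,3) by (simp add: prime_dvd_mult_iff)
qed

text \<open>Vandermonde for p + p a. For 0 < k < p both factors of the k-th term have an upper index
  divisible by p and a lower index that is not, so the term is divisible by p^2. The terms k = 0 and
  k = p reproduce Pascal's rule.\<close>

lemma choose_prime_mult_cong:
  assumes "prime p"
  shows "[(p * a) choose (p * b) = a choose b] (mod p\<^sup>2)"
proof (induction a arbitrary: b)
  case 0
  show ?case using prime_gt_0_nat[OF assms] by (cases b) (auto simp: binomial_eq_0)
next
  case (Suc a)
  show ?case
  proof (cases b)
    case 0
    then show ?thesis by simp
  next
    case (Suc c)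
    define f where "f k = (p choose k) * ((p * a) choose (p * b - k))" for k
    have p0: "p > 0" using prime_gt_0_nat[OF assms] .
    have le: "p \<le> p * b" using Suc by simp
    have "(p * Suc a) choose (p * b) = (\<Sum>k\<le>p * b. f k)"
      unfolding f_def vandermonde by (simp add: add.commute)
    also have "\<dots> = (\<Sum>k\<le>p. f k)"
      using le by (intro sum.mono_neutral_right) (auto simp: f_def binomial_eq_0)
    also have "{..p} = insert 0 (insert p {0<..<p})" using p0 by auto
    also have "sum f \<dots> = f 0 + (f p + sum f {0<..<p})" using p0 by simp
    finally have eq: "(p * Suc a) choose (p * b) = f 0 + (f p + sum f {0<..<p})" .
    have "p\<^sup>2 dvd f k" if "k \<in> {0<..<p}" for k
    proof -
      have nd: "\<not> p dvd k" using that by (auto dest: dvd_imp_le)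
      moreover have "\<not> p dvd p * b - k"
        using nd that le by (metis dvd_diffD1 dvd_triv_left greaterThanLessThan_iff le_trans less_imp_le)
      ultimately show ?thesis
        unfolding f_def power2_eq_square
        by (intro mult_dvd_mono prime_dvd_choose_if_dvd_upper[OF assms]) auto
    qed
    hence "p\<^sup>2 dvd sum f {0<..<p}" by (rule dvd_sum)
    hence "[(p * Suc a) choose (p * b) = f 0 + (f p + 0)] (mod p\<^sup>2)"
      unfolding eq by (intro cong_add cong_refl) (simp add: cong_0_iff)
    also have "f 0 + (f p + 0) = ((p * a) choose (p * b)) + ((p * a) choose (p * c))"
      by (simp add: f_def Suc)
    also have "[\<dots> = (a choose b) + (a choose c)] (mod p\<^sup>2)"
      by (intro cong_add Suc.IH)
    also have "(a choose b) + (a choose c) = Suc a choose b" by (simp add: Suc)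
    finally show ?thesis .
  qed
qed

section \<open>Binomial coefficients as quotients of rising factorials\<close>

lemma fact_add_pochhammer: "fact (m + n) = fact m * pochhammer (int m + 1) n"
  by (simp add: pochhammer_fact pochhammer_product' add.commute)

text \<open>Each of the three factorials in the larger coefficient is a factorial from
  \<open>n choose k\<close> times a rising factorial. For \<open>n = p * a\<close> and
  \<open>k = p * b\<close> these have the shape expanded in
  \<open>pochhammer_cong_harm_mod\<close>.\<close>

lemma choose_add_mult_pochhammer:
  assumes "k \<le> n" "s \<le> r"
  shows "int ((n + r) choose (k + s)) * pochhammer (int k + 1) s * pochhammer (int (n - k) + 1) (r - s)
       = int (n choose k) * pochhammer (int n + 1) r"
proof -
  have split: "n + r - (k + s) = (n - k) + (r - s)" using assms by simp
  have F: "fact k * fact (n - k) * int (n choose k) = fact n" if "k \<le> n" for k n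
    using arg_cong[OF binomial_fact_lemma[OF that], of int] by simp
  have "(fact k * fact (n - k)) *
      (int ((n + r) choose (k + s)) * pochhammer (int k + 1) s * pochhammer (int (n - k) + 1) (r - s))
      = fact (k + s) * fact (n + r - (k + s)) * int ((n + r) choose (k + s))"
    unfolding split fact_add_pochhammer by (simp only: mult_ac)
  also have "\<dots> = fact n * pochhammer (int n + 1) r"
    using assms by (subst F) (auto simp: fact_add_pochhammer)
  also have "\<dots> = (fact k * fact (n - k)) * (int (n choose k) * pochhammer (int n + 1) r)"
    by (simp only: F[OF assms(1), symmetric] mult_ac)
  finally show ?thesis by simp
qed

lemma coprime_fact_prime_square:
  assumes "prime p" "n < p"
  shows "coprime (fact n) ((int p)\<^sup>2)"
proof -
  have "\<not> p dvd fact n" using assms by (simp add: prime_dvd_fact_iff)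
  hence "coprime (fact n) p" using assms(1) by (metis coprime_commute prime_imp_coprime)
  hence "coprime (int (fact n)) (int p)" by (simp only: coprime_int_iff)
  thus ?thesis by simp
qed

text \<open>The coefficient divides \<open>fact r\<close>, which is a unit modulo p^2.\<close>

lemma coprime_choose_prime:
  assumes "prime p" "r < p" "s \<le> r"
  shows "coprime (int (r choose s)) (int p)"
proof -
  have "(r choose s) dvd fact r"
    using binomial_fact_lemma[OF assms(3)] by (metis dvd_triv_right)
  hence "int (r choose s) dvd fact r" by (metis of_nat_dvd_iff of_nat_fact)
  from coprime_divisors[OF this dvd_refl coprime_fact_prime_square[OF assms(1,2)]]
  show ?thesis by simp
qed

text \<open>Modulo q^2 the inverse of 1 + q u is 1 - q u; both sides are multiplied by it.\<close>

lemma cong_one_plus_mult_square_inverse: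
  fixes q :: int
  assumes "[z * (1 + q * u) = c * (1 + q * v)] (mod q\<^sup>2)"
  shows "[z = c * (1 + q * (v - u))] (mod q\<^sup>2)"
proof -
  have "[z * (1 + q * u) * (1 - q * u) = c * (1 + q * v) * (1 - q * u)] (mod q\<^sup>2)"
    using assms by (rule cong_mult) simp
  moreover have "z * (1 + q * u) * (1 - q * u) = z + q\<^sup>2 * (- z * u * u)"
    by (simp add: algebra_simps power2_eq_square)
  moreover have "c * (1 + q * v) * (1 - q * u) = c * (1 + q * (v - u)) + q\<^sup>2 * (- c * u * v)"
    by (simp add: algebra_simps power2_eq_square)
  ultimately have "[z + q\<^sup>2 * (- z * u * u) = c * (1 + q * (v - u)) + q\<^sup>2 * (- c * u * v)] (mod q\<^sup>2)"
    by (simp only:)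
  thus ?thesis by (simp only: cong_def mod_mult_self2)
qed

lemma cong_one_plus_mult_square_iff:
  assumes "prime p" "coprime c (int p)"
  shows "[c * (1 + int p * x) = c * (1 + int p * y)] (mod (int p)\<^sup>2) \<longleftrightarrow> [x = y] (mod int p)"
proof -
  have "[c * (1 + int p * x) = c * (1 + int p * y)] (mod (int p)\<^sup>2)
      \<longleftrightarrow> [1 + int p * x = 1 + int p * y] (mod (int p)\<^sup>2)"
    using assms(2) by (intro cong_mult_lcancel) simp
  also have "\<dots> \<longleftrightarrow> int p * int p dvd int p * (x - y)"
    by (simp add: cong_iff_dvd_diff power2_eq_square right_diff_distrib)
  also have "\<dots> \<longleftrightarrow> [x = y] (mod int p)"
    using prime_gt_0_nat[OF assms(1)] by (simp add: cong_iff_dvd_diff)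
  finally show ?thesis .
qed

text \<open>The upper rising factorial contributes a H_r, the two lower ones b H_s and (a - b)
  H_(r-s). The opening rule moves the lower contribution \<open>u\<close> to the left, which avoids
  division.\<close>

lemma choose_prime_mult_add_cong:
  assumes "prime p" "r < p" "s \<le> r" "b \<le> a"
  shows "[int ((p * a + r) choose (p * b + s)) = int (a choose b) * int (r choose s) *
           (1 + int p * (int a * harm_mod p r
                - (int b * harm_mod p s + int (a - b) * harm_mod p (r - s))))] (mod (int p)\<^sup>2)"
proof (rule cong_one_plus_mult_square_inverse)
  let ?q = "(int p)\<^sup>2"
  let ?h = "harm_mod p"
  define Z where "Z = int ((p * a + r) choose (p * b + s))"
  define u where "u = int b * ?h s + int (a - b) * ?h (r - s)"
  define t where "t = (fact s * fact (r - s) :: int)"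
  have cop: "coprime t ?q"
    unfolding t_def using assms
    by (intro coprime_mult_left_iff[THEN iffD2] conjI coprime_fact_prime_square) auto
  have F: "t * int (r choose s) = fact r"
    unfolding t_def using arg_cong[OF binomial_fact_lemma[OF assms(3)], of int] by simp
  \<comment> \<open>The factor 1 + p u splits into one factor for each lower rising factorial, up to
    a multiple of p^2; \<open>t\<close> supplies the factorials that their expansions
    require.\<close>
  have "t * (Z * (1 + int p * u))
      = Z * (fact s * (1 + int p * (int b * ?h s)))
          * (fact (r - s) * (1 + int p * (int (a - b) * ?h (r - s))))
        + ?q * (- t * Z * (int b * ?h s) * (int (a - b) * ?h (r - s)))"
    by (simp add: t_def u_def algebra_simps power2_eq_square)
  also have "[\<dots> = Z * (fact s * (1 + int p * (int b * ?h s)))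
          * (fact (r - s) * (1 + int p * (int (a - b) * ?h (r - s))))] (mod ?q)"
    by (simp add: cong_iff_dvd_diff)
  also have "[Z * (fact s * (1 + int p * (int b * ?h s)))
          * (fact (r - s) * (1 + int p * (int (a - b) * ?h (r - s))))
      = Z * pochhammer (int p * int b + 1) s
          * pochhammer (int p * int (a - b) + 1) (r - s)] (mod ?q)"
    using assms by (intro cong_mult cong_refl cong_sym[OF pochhammer_cong_harm_mod]) auto
  also have "Z * pochhammer (int p * int b + 1) s * pochhammer (int p * int (a - b) + 1) (r - s)
      = int ((p * a) choose (p * b)) * pochhammer (int p * int a + 1) r"
    using choose_add_mult_pochhammer[of "p * b" "p * a" s r] assms
    by (simp add: Z_def flip: diff_mult_distrib2)
  also have "[\<dots> = int (a choose b) * (fact r * (1 + int p * (int a * ?h r)))] (mod ?q)"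
    using choose_prime_mult_cong[OF assms(1), of a b] assms
    by (intro cong_mult pochhammer_cong_harm_mod) (simp_all flip: cong_int_iff)
  also have "int (a choose b) * (fact r * (1 + int p * (int a * ?h r)))
      = t * (int (a choose b) * int (r choose s) * (1 + int p * (int a * ?h r)))"
    by (simp only: F[symmetric] mult_ac)
  finally show "[Z * (1 + int p * u)
      = int (a choose b) * int (r choose s) * (1 + int p * (int a * ?h r))] (mod ?q)"
    by (simp only: cong_mult_lcancel[OF cop])
qed

text \<open>Each factor -n + i is -(n - i). The detour through the reals allows the quotient in
  \<open>gbinomial_pochhammer\<close>.\<close>

lemma fact_mult_choose_pochhammer_minus:
  "(-1) ^ k * int (n choose k) * fact k = pochhammer (- int n) k"
proof -
  have "real_of_int ((-1) ^ k * int (n choose k) * fact k) = real_of_int (pochhammer (- int n) k)"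
    by (simp add: binomial_gbinomial gbinomial_pochhammer flip: pochhammer_of_int)
  thus ?thesis by (simp only: of_int_eq_iff)
qed

text \<open>The rising factorial of 1 - p of length r splits after s factors, and its tail is
  \<open>Y * fact (r - s)\<close>. Expanding the whole and the head at x = -1 and dividing gives the
  claim.\<close>

lemma choose_prime_minus_cong:
  assumes "prime p" "r < p" "s \<le> r"
  shows "[(-1) ^ (r - s) * int ((p - 1 - s) choose (r - s))
           = int (r choose s) * (1 + int p * (harm_mod p s - harm_mod p r))] (mod (int p)\<^sup>2)"
proof -
  let ?q = "(int p)\<^sup>2"
  let ?h = "harm_mod p"
  define Y where "Y = (-1) ^ (r - s) * int ((p - 1 - s) choose (r - s))"
  define t where "t = (fact s * fact (r - s) :: int)"
  have cop: "coprime t ?q"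
    unfolding t_def using assms
    by (intro coprime_mult_left_iff[THEN iffD2] conjI coprime_fact_prime_square) auto
  have F: "t * int (r choose s) = fact r"
    unfolding t_def using arg_cong[OF binomial_fact_lemma[OF assms(3)], of int] by simp
  \<comment> \<open>As s < p, the subtraction in \<open>p - 1 - s\<close> is exact and its negative
    is 1 - p + s.\<close>
  have Y: "Y * fact (r - s) = pochhammer (int p * (-1) + 1 + int s) (r - s)"
    unfolding Y_def fact_mult_choose_pochhammer_minus using assms by (simp add: of_nat_diff algebra_simps)
  have "t * (Y * (1 + int p * (- ?h s))) = fact s * (1 + int p * ((-1) * ?h s)) * (Y * fact (r - s))"
    by (simp add: t_def)
  also have "[\<dots> = pochhammer (int p * (-1) + 1) s * (Y * fact (r - s))] (mod ?q)"
    using assms by (intro cong_mult cong_refl cong_sym[OF pochhammer_cong_harm_mod]) auto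
  also have "pochhammer (int p * (-1) + 1) s * (Y * fact (r - s)) = pochhammer (int p * (-1) + 1) r"
    unfolding Y using assms(3) by (simp add: pochhammer_product)
  also have "[\<dots> = fact r * (1 + int p * ((-1) * ?h r))] (mod ?q)"
    using assms by (intro pochhammer_cong_harm_mod)
  also have "fact r * (1 + int p * ((-1) * ?h r)) = t * (int (r choose s) * (1 + int p * (- ?h r)))"
    by (simp only: F[symmetric] mult_ac mult_minus1)
  finally have "[Y * (1 + int p * (- ?h s)) = int (r choose s) * (1 + int p * (- ?h r))] (mod ?q)"
    by (simp only: cong_mult_lcancel[OF cop])
  from cong_one_plus_mult_square_inverse[OF this] show ?thesis
    by (simp add: Y_def)
qed

section \<open>The three equivalent conditions\<close>

lemma mem_D_iff_harm_mod:
  assumes "prime p" "r < p" "s \<le> r"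
  shows "(r, s) \<in> D p \<longleftrightarrow> [harm_mod p r = harm_mod p (r - s)] (mod int p)
                         \<and> [harm_mod p (r - s) = harm_mod p s] (mod int p)"
proof -
  let ?h = "harm_mod p"
  define P where "P a b \<longleftrightarrow>
    [(p * a + r) choose (p * b + s) = (a choose b) * (r choose s)] (mod p\<^sup>2)" for a b
  define e where "e a b = int a * ?h r - (int b * ?h s + int (a - b) * ?h (r - s))" for a b
  have cop: "coprime (int (r choose s)) (int p)" using assms by (rule coprime_choose_prime)
  have P_iff: "P a b \<longleftrightarrow> [int (a choose b) * int (r choose s) * (1 + int p * e a b)
      = int (a choose b) * int (r choose s)] (mod (int p)\<^sup>2)" if "b \<le> a" for a b
    using choose_prime_mult_add_cong[OF assms that]
    unfolding P_def e_def cong_int_iff[symmetric] of_nat_mult of_nat_power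
    by (auto intro: cong_trans cong_sym)
  \<comment> \<open>For a = 1 the remaining factor \<open>r choose s\<close> is a unit, so the
    condition on \<open>e\<close> is an equivalence; in general \<open>a choose b\<close> may be
    divisible by p.\<close>
  have P_test: "P 1 b \<longleftrightarrow> [e 1 b = 0] (mod int p)" if "b \<le> 1" for b
  proof -
    have "1 choose b = 1" using that by (cases b) auto
    thus ?thesis
      using P_iff[OF that] cong_one_plus_mult_square_iff[OF assms(1) cop, of "e 1 b" 0] by simp
  qed
  have "(r, s) \<in> D p \<longleftrightarrow> (\<forall>a b. P a b)"
    using assms by (auto simp: D_def P_def)
  also have "\<dots> \<longleftrightarrow> [?h r = ?h (r - s)] (mod int p) \<and> [?h r = ?h s] (mod int p)"
  proof (intro iffI allI)
    assume "\<forall>a b. P a b"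
    hence "[e 1 0 = 0] (mod int p)" "[e 1 1 = 0] (mod int p)" using P_test by auto
    thus "[?h r = ?h (r - s)] (mod int p) \<and> [?h r = ?h s] (mod int p)"
      by (simp add: e_def cong_iff_dvd_diff)
  next
    fix a b
    assume h: "[?h r = ?h (r - s)] (mod int p) \<and> [?h r = ?h s] (mod int p)"
    show "P a b"
    proof (cases "b \<le> a")
      case False
      \<comment> \<open>Here b > a, and r < p keeps the upper index below the lower one, so both
        sides vanish.\<close>
      hence "p * Suc a \<le> p * b" by (intro mult_le_mono) auto
      hence "p * a + r < p * b + s" using assms(2) by simp
      thus ?thesis using False by (simp add: P_def binomial_eq_0)
    next
      case True
      \<comment> \<open>Splitting a H_r along a = b + (a - b) makes every \<open>e a b\<close> a
        combination of \<open>e 1 1\<close> and \<open>e 1 0\<close>.\<close>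
      hence "e a b = int b * (?h r - ?h s) + int (a - b) * (?h r - ?h (r - s))"
        by (simp add: e_def of_nat_diff algebra_simps)
      hence "int p dvd e a b" using h by (simp add: cong_iff_dvd_diff)
      hence "(int p)\<^sup>2 dvd int (a choose b) * int (r choose s) * (int p * e a b)"
        unfolding power2_eq_square by (intro dvd_mult mult_dvd_mono) auto
      thus ?thesis
        unfolding P_iff[OF True] by (simp add: cong_iff_dvd_diff algebra_simps)
    qed
  qed
  also have "\<dots> \<longleftrightarrow> [?h r = ?h (r - s)] (mod int p) \<and> [?h (r - s) = ?h s] (mod int p)"
    by (auto intro: cong_trans cong_sym)
  finally show ?thesis .
qed

theorem theorem8:
  fixes p r s :: nat
  assumes "prime p" and "s \<le> r" and "r \<le> p - 1"
  shows "((r, s) \<in> D p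
           \<longleftrightarrow> p_cong p (harm r :: real) (harm (r - s)) \<and> p_cong p (harm (r - s) :: real) (harm s))
       \<and> ((r, s) \<in> D p
           \<longleftrightarrow> [int (r choose s) = (-1) ^ (r - s) * int ((p - 1 - s) choose (r - s))] (mod (int p)\<^sup>2)
             \<and> [(-1) ^ (r - s) * int ((p - 1 - s) choose (r - s))
                 = (-1) ^ s * int ((p - 1 - r + s) choose s)] (mod (int p)\<^sup>2))"
proof
  have rp: "r < p" using assms(3) prime_gt_0_nat[OF assms(1)] by linarith
  note D = mem_D_iff_harm_mod[OF assms(1) rp assms(2)]
  show "(r, s) \<in> D p
      \<longleftrightarrow> p_cong p (harm r :: real) (harm (r - s)) \<and> p_cong p (harm (r - s) :: real) (harm s)"
    using D rp assms(2) by (simp add: p_cong_harm_iff[OF assms(1)])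
  let ?h = "harm_mod p" and ?q = "(int p)\<^sup>2"
  define c where "c = int (r choose s)"
  define Y where "Y = (-1) ^ (r - s) * int ((p - 1 - s) choose (r - s))"
  define Z where "Z = (-1) ^ s * int ((p - 1 - r + s) choose s)"
  have "coprime c (int p)"
    unfolding c_def using assms(1) rp assms(2) by (rule coprime_choose_prime)
  note iff = cong_one_plus_mult_square_iff[OF assms(1) this]
  have Y: "[Y = c * (1 + int p * (?h s - ?h r))] (mod ?q)"
    unfolding Y_def c_def using assms(1) rp assms(2) by (rule choose_prime_minus_cong)
  \<comment> \<open>The second signed coefficient is the first with s replaced by r - s, so the same
    expansion applies.\<close>
  have "p - 1 - (r - s) = p - 1 - r + s" "r - (r - s) = s" "r choose (r - s) = r choose s"
    using assms(2,3) binomial_symmetric[OF assms(2)] by auto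
  hence Z: "[Z = c * (1 + int p * (?h (r - s) - ?h r))] (mod ?q)"
    using choose_prime_minus_cong[OF assms(1) rp, of "r - s"] by (simp add: Z_def c_def)
  \<comment> \<open>All three quantities are now \<open>c\<close> times a first-order term, with
    coefficients 0, H_s - H_r and H_(r-s) - H_r, which are compared modulo p.\<close>
  have "[c = Y] (mod ?q) \<longleftrightarrow> [c * (1 + int p * 0) = c * (1 + int p * (?h s - ?h r))] (mod ?q)"
    using Y by (auto intro: cong_trans cong_sym)
  also have "\<dots> \<longleftrightarrow> [?h r = ?h s] (mod int p)"
    unfolding iff by (simp add: cong_iff_dvd_diff)
  finally have cY: "[c = Y] (mod ?q) \<longleftrightarrow> [?h r = ?h s] (mod int p)" .
  have "[Y = Z] (mod ?q) \<longleftrightarrow> [c * (1 + int p * (?h s - ?h r))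
      = c * (1 + int p * (?h (r - s) - ?h r))] (mod ?q)"
    using Y Z by (meson cong_trans cong_sym)
  also have "\<dots> \<longleftrightarrow> [?h s = ?h (r - s)] (mod int p)"
    unfolding iff by (simp add: cong_iff_dvd_diff)
  finally have YZ: "[Y = Z] (mod ?q) \<longleftrightarrow> [?h s = ?h (r - s)] (mod int p)" .
  have "(r, s) \<in> D p \<longleftrightarrow> [c = Y] (mod ?q) \<and> [Y = Z] (mod ?q)"
    unfolding D cY YZ by (auto intro: cong_trans cong_sym)
  thus "(r, s) \<in> D p
           \<longleftrightarrow> [int (r choose s) = (-1) ^ (r - s) * int ((p - 1 - s) choose (r - s))] (mod (int p)\<^sup>2)
             \<and> [(-1) ^ (r - s) * int ((p - 1 - s) choose (r - s))
                 = (-1) ^ s * int ((p - 1 - r + s) choose s)] (mod (int p)\<^sup>2)"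
    by (simp only: c_def Y_def Z_def)
qed

end
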